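(* Let $(B_t)_{t\ge 0}$ be a standard fractional Brownian motion with Hurst parameter $H\in[1/2,1)$, let $t>0$, and let $M_t^{H,-}=\sup_{0\le u\le v\le t}(B_u-B_v)$ be its maximum loss up to time $t$. Then $$\lim_{x\to\infty}\frac{1}{x^2}\log P(M_t^{H,-}>x)=-\frac{1}{2t^{2H}}.$$
   Context: A standard fractional Brownian motion $(B_t)_{t\ge0}$ with Hurst parameter $H\in(0,1)$ is a continuous centered Gaussian process with $B_0=0$ and covariance $E[B_tB_s]=\frac12\left(t^{2H}+s^{2H}-|t-s|^{2H}\right)$. *)

theory Defs
  imports "HOL-Probability.Probability"
begin

(* The case \<sigma> = 0 is separate because normal_density \<mu> 0 is constantly 0:
   a constant random variable counts as Gaussian. *)
definition gaussian_rv :: "'a measure \<Rightarrow> ('a \<Rightarrow> real) \<Rightarrow> bool" where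
  "gaussian_rv M X \<longleftrightarrow>
     X \<in> borel_measurable M \<and>
     (\<exists>\<mu> \<sigma>. 0 \<le> \<sigma> \<and>
        distr M borel X =
          (if \<sigma> = 0 then return borel \<mu> else density lborel (normal_density \<mu> \<sigma>)))"

(* Joint Gaussianity of the finite-dimensional marginals, in the form that every finite
   linear combination is Gaussian. *)
definition gaussian_process :: "'a measure \<Rightarrow> 'i set \<Rightarrow> ('i \<Rightarrow> 'a \<Rightarrow> real) \<Rightarrow> bool" where
  "gaussian_process M T X \<longleftrightarrow>
     (\<forall>F c. finite F \<and> F \<subseteq> T \<longrightarrow> gaussian_rv M (\<lambda>\<omega>. \<Sum>i\<in>F. c i * X i \<omega>))"

(* The time set is the half-line; values of B at negative times are irrelevant.
   Every sample path is required to be continuous, whereas B 0 = 0 is only required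
   almost surely. Note that 0 powr (2 * H) = 0. *)
locale fractional_brownian_motion = prob_space M
  for M :: "'a measure" +
  fixes H :: real and B :: "real \<Rightarrow> 'a \<Rightarrow> real"
  assumes Hurst_pos: "0 < H" and Hurst_less_1: "H < 1"
    and gaussian: "gaussian_process M {0..} B"
    and centered: "\<And>t. 0 \<le> t \<Longrightarrow> expectation (B t) = 0"
    and continuous_paths: "\<And>\<omega>. \<omega> \<in> space M \<Longrightarrow> continuous_on {0..} (\<lambda>t. B t \<omega>)"
    and initial: "AE \<omega> in M. B 0 \<omega> = 0"
    and covariance: "\<And>s t. 0 \<le> s \<Longrightarrow> 0 \<le> t \<Longrightarrow>
      expectation (\<lambda>\<omega>. B t \<omega> * B s \<omega>) =
        1 / 2 * (t powr (2 * H) + s powr (2 * H) - \<bar>t - s\<bar> powr (2 * H))"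

(* A supremum in the reals: for t \<ge> 0 and a continuous path it is taken over a
   nonempty bounded set. *)
definition maximum_loss :: "(real \<Rightarrow> 'a \<Rightarrow> real) \<Rightarrow> real \<Rightarrow> 'a \<Rightarrow> real" where
  "maximum_loss B t \<omega> = (SUP (u, v)\<in>{(u, v). 0 \<le> u \<and> u \<le> v \<and> v \<le> t}. B u \<omega> - B v \<omega>)"

end

theory Submission
  imports Defs "HOL-Real_Asymp.Real_Asymp"
begin

text \<open>
  The lower bound comes from the single pair \<open>u = 0\<close>, \<open>v = t\<close>, whose increment has variance
  \<open>t powr (2 * H)\<close>. For the upper bound, fix \<open>\<delta> > 0\<close>. Off the event that some dyadic increment of
  level \<open>k + 1 > m\<close> exceeds \<open>x r\<^sup>k\<close> with \<open>r = 2 powr (- H / 2)\<close>, chaining moves each point to the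
  dyadic grid of level \<open>m\<close> at a cost of at most \<open>x \<delta> / 2\<close>, if \<open>m\<close> is large. What is left is a maximum of finitely
  many Gaussian variables of variance at most \<open>t powr (2 * H)\<close>. The exceptional event is negligible:
  as \<open>r\<^sup>k\<close> decays more slowly than the standard deviation of the increments, the union bound
  gives a convergent series with sum \<open>O(exp (- x\<^sup>2 / (2 * t powr (2 * H))))\<close>.
\<close>

section \<open>Tail bounds for centred normal laws\<close>

lemma normal_upper_tail_le:
  assumes "0 < \<sigma>" "0 \<le> y"
  shows "measure (density lborel (normal_density 0 \<sigma>)) {y<..} \<le> exp (- y\<^sup>2 / (2 * \<sigma>\<^sup>2))"
proof -
  interpret N: prob_space "density lborel (normal_density 0 \<sigma>)"
    using assms by (rule_tac prob_space_normal_density)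
  \<comment> \<open>\<open>s\<^sup>2 \<ge> y\<^sup>2 + (s - y)\<^sup>2\<close> for \<open>s > y \<ge> 0\<close>, so compare with the density centred at \<open>y\<close>\<close>
  have pw: "normal_density 0 \<sigma> s * indicator {y<..} s \<le> exp (- y\<^sup>2 / (2 * \<sigma>\<^sup>2)) * normal_density y \<sigma> s" for s
  proof (cases "s > y")
    case True
    have "s\<^sup>2 = y\<^sup>2 + (s - y)\<^sup>2 + 2 * (y * (s - y))"
      by (simp add: power2_eq_square algebra_simps)
    moreover have "y * (s - y) \<ge> 0"
      using True assms by simp
    ultimately have "y\<^sup>2 + (s - y)\<^sup>2 \<le> s\<^sup>2" by linarith
    then have "- s\<^sup>2 / (2 * \<sigma>\<^sup>2) \<le> - y\<^sup>2 / (2 * \<sigma>\<^sup>2) + - (s - y)\<^sup>2 / (2 * \<sigma>\<^sup>2)"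
      unfolding add_divide_distrib[symmetric] by (intro divide_right_mono) auto
    then have "exp (- s\<^sup>2 / (2 * \<sigma>\<^sup>2)) \<le> exp (- y\<^sup>2 / (2 * \<sigma>\<^sup>2)) * exp (- (s - y)\<^sup>2 / (2 * \<sigma>\<^sup>2))"
      by (simp add: exp_add[symmetric])
    then have "1 / sqrt (2 * pi * \<sigma>\<^sup>2) * exp (- s\<^sup>2 / (2 * \<sigma>\<^sup>2))
        \<le> 1 / sqrt (2 * pi * \<sigma>\<^sup>2) * (exp (- y\<^sup>2 / (2 * \<sigma>\<^sup>2)) * exp (- (s - y)\<^sup>2 / (2 * \<sigma>\<^sup>2)))"
      by (intro mult_left_mono) auto
    then show ?thesis
      using True by (simp add: normal_density_def mult_ac)
  qed simp
  have "ennreal (N.prob {y<..}) = (\<integral>\<^sup>+s. ennreal (normal_density 0 \<sigma> s * indicator {y<..} s) \<partial>lborel)"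
    unfolding N.emeasure_eq_measure[symmetric]
    by (subst emeasure_density) (auto intro!: nn_integral_cong simp: indicator_def)
  also have "\<dots> \<le> (\<integral>\<^sup>+s. ennreal (exp (- y\<^sup>2 / (2 * \<sigma>\<^sup>2)) * normal_density y \<sigma> s) \<partial>lborel)"
    by (intro nn_integral_mono ennreal_leI pw)
  also have "\<dots> = ennreal (\<integral>s. exp (- y\<^sup>2 / (2 * \<sigma>\<^sup>2)) * normal_density y \<sigma> s \<partial>lborel)"
    using assms by (intro nn_integral_eq_integral) auto
  also have "\<dots> = ennreal (exp (- y\<^sup>2 / (2 * \<sigma>\<^sup>2)))"
    using assms by simp
  finally show ?thesis by simp
qed

text \<open>The density decreases on the positive axis, so on the unit interval
  \<open>{y<..y+1}\<close> it is at least its value at \<open>y + 1\<close>. The bound is crude, but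
  the shift by 1 disappears on the scale \<open>ln p / x^2\<close>.\<close>

lemma normal_upper_tail_ge:
  assumes "0 < \<sigma>" "0 \<le> y"
  shows "normal_density 0 \<sigma> (y + 1) \<le> measure (density lborel (normal_density 0 \<sigma>)) {y<..}"
proof -
  interpret N: prob_space "density lborel (normal_density 0 \<sigma>)"
    using assms by (rule_tac prob_space_normal_density)
  have pw: "normal_density 0 \<sigma> (y + 1) * indicator {y<..y+1} s \<le> normal_density 0 \<sigma> s * indicator {y<..} s" for s
  proof (cases "s \<in> {y<..y+1}")
    case True
    then have "s\<^sup>2 \<le> (y + 1)\<^sup>2"
      using assms by (intro power_mono) auto
    then have "- (y + 1)\<^sup>2 / (2 * \<sigma>\<^sup>2) \<le> - s\<^sup>2 / (2 * \<sigma>\<^sup>2)"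
      by (intro divide_right_mono) auto
    then have "exp (- (y + 1)\<^sup>2 / (2 * \<sigma>\<^sup>2)) \<le> exp (- s\<^sup>2 / (2 * \<sigma>\<^sup>2))"
      by simp
    then have "1 / sqrt (2 * pi * \<sigma>\<^sup>2) * exp (- (y + 1)\<^sup>2 / (2 * \<sigma>\<^sup>2))
        \<le> 1 / sqrt (2 * pi * \<sigma>\<^sup>2) * exp (- s\<^sup>2 / (2 * \<sigma>\<^sup>2))"
      by (intro mult_left_mono) auto
    then show ?thesis
      using True by (simp add: normal_density_def)
  qed auto
  have "ennreal (normal_density 0 \<sigma> (y + 1)) = (\<integral>\<^sup>+s. ennreal (normal_density 0 \<sigma> (y + 1)) * indicator {y<..y+1} s \<partial>lborel)"
    by (subst nn_integral_cmult_indicator) auto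
  also have "\<dots> \<le> (\<integral>\<^sup>+s. ennreal (normal_density 0 \<sigma> s * indicator {y<..} s) \<partial>lborel)"
    by (intro nn_integral_mono order_trans[OF _ ennreal_leI[OF pw]]) (auto simp: indicator_def)
  also have "\<dots> = ennreal (N.prob {y<..})"
    unfolding N.emeasure_eq_measure[symmetric]
    by (subst emeasure_density) (auto intro!: nn_integral_cong simp: indicator_def)
  finally show ?thesis by (simp add: ennreal_le_iff)
qed

section \<open>Gaussian variables and their second moments\<close>

context prob_space
begin

text \<open>A point mass has no Lebesgue density, so the degenerate law becomes almost sure
  constancy. Otherwise \<open>distributed\<close> applies, after replacing \<open>borel\<close> by
  \<open>lborel\<close>, which has the same sets.\<close>

lemma gaussian_rv_cases:
  assumes "gaussian_rv M X"
  obtains (const) \<mu> where "AE \<omega> in M. X \<omega> = \<mu>"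
  | (normal) \<mu> \<sigma> where "0 < \<sigma>" "distributed M lborel X (normal_density \<mu> \<sigma>)"
proof -
  obtain \<mu> \<sigma> where X: "X \<in> borel_measurable M" and "0 \<le> \<sigma>"
    and d: "distr M borel X = (if \<sigma> = 0 then return borel \<mu> else density lborel (normal_density \<mu> \<sigma>))"
    using assms unfolding gaussian_rv_def by blast
  show thesis
  proof (cases "\<sigma> = 0")
    case True
    then have ret: "distr M borel X = return borel \<mu>"
      using d by (simp only: if_True simp_thms)
    have "AE z in distr M borel X. z = \<mu>"
      unfolding ret by (subst AE_return) auto
    with X have "AE \<omega> in M. X \<omega> = \<mu>"
      by (rule AE_distrD)
    then show thesis by (rule const)
  next
    case False
    have "distr M lborel X = distr M borel X"
      by (rule distr_cong) simp_all
    also have "\<dots> = density lborel (normal_density \<mu> \<sigma>)"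
      using False d by (simp only: if_False)
    finally have "distributed M lborel X (normal_density \<mu> \<sigma>)"
      using X by (simp add: distributed_def)
    moreover have "0 < \<sigma>" using False \<open>0 \<le> \<sigma>\<close> by simp
    ultimately show thesis by (rule normal[rotated])
  qed
qed

text \<open>Write \<open>x^2\<close> as \<open>(x - \<mu>)^2 + 2 * \<mu> * x - \<mu>^2\<close> under
  the density. Expectations split over sums only for integrable terms, so this is what allows
  covariances to be expanded.\<close>

lemma gaussian_rv_square_integrable:
  assumes "gaussian_rv M X"
  shows "integrable M (\<lambda>\<omega>. (X \<omega>)\<^sup>2)"
proof -
  have X[measurable]: "X \<in> borel_measurable M"
    using assms by (simp add: gaussian_rv_def)
  from assms show ?thesis
  proof (cases rule: gaussian_rv_cases)
    case (const \<mu>)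
    have "integrable M (\<lambda>\<omega>. (X \<omega>)\<^sup>2) \<longleftrightarrow> integrable M (\<lambda>\<omega>. \<mu>\<^sup>2)"
      by (intro integrable_cong_AE) (use const in auto)
    then show ?thesis by simp
  next
    case (normal \<mu> \<sigma>)
    have "integrable lborel (\<lambda>x. normal_density \<mu> \<sigma> x * (x - \<mu>)^2 + 2 * \<mu> * (normal_density \<mu> \<sigma> x * x) - \<mu>\<^sup>2 * normal_density \<mu> \<sigma> x)"
      using normal(1) by (intro Bochner_Integration.integrable_diff Bochner_Integration.integrable_add
        integrable_mult_right integrable_normal_moment integrable_normal_moment_nz_1 integrable_normal_density) auto
    also have "(\<lambda>x. normal_density \<mu> \<sigma> x * (x - \<mu>)^2 + 2 * \<mu> * (normal_density \<mu> \<sigma> x * x) - \<mu>\<^sup>2 * normal_density \<mu> \<sigma> x)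
      = (\<lambda>x. normal_density \<mu> \<sigma> x * x\<^sup>2)"
      by (auto simp: fun_eq_iff power2_eq_square algebra_simps)
    finally show ?thesis
      by (subst (asm) distributed_integrable[OF normal(2)]) auto
  qed
qed

lemma gaussian_rv_integrable:
  assumes "gaussian_rv M X"
  shows "integrable M X"
  using assms by (intro square_integrable_imp_integrable[OF _ gaussian_rv_square_integrable])
    (auto simp: gaussian_rv_def)

text \<open>A positive second moment excludes the almost surely constant case; in the other case
  mean and variance determine both parameters.\<close>

lemma gaussian_rv_centered_distributed:
  assumes g: "gaussian_rv M X" and "expectation X = 0" and v: "expectation (\<lambda>\<omega>. (X \<omega>)\<^sup>2) = s\<^sup>2" and s: "0 < s"
  shows "distributed M lborel X (normal_density 0 s)"
  using g
proof (cases rule: gaussian_rv_cases)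
  case (const \<mu>)
  have X[measurable]: "X \<in> borel_measurable M"
    using assms by (simp add: gaussian_rv_def)
  have "expectation X = expectation (\<lambda>_. \<mu>)"
    by (intro integral_cong_AE) (use const in auto)
  with assms have "\<mu> = 0" by (simp add: prob_space)
  have "expectation (\<lambda>\<omega>. (X \<omega>)\<^sup>2) = expectation (\<lambda>_. 0)"
    by (intro integral_cong_AE) (use const \<open>\<mu> = 0\<close> in auto)
  with v s show ?thesis by simp
next
  case (normal \<mu> \<sigma>)
  have "\<mu> = 0"
    using normal_distributed_expectation[OF normal] assms by simp
  moreover have "\<sigma>\<^sup>2 = s\<^sup>2"
    using normal_distributed_variance[OF normal] assms by simp
  ultimately show ?thesis using normal s by (simp add: power2_eq_iff)
qed

end

section \<open>Law and tails of the increments\<close>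

context fractional_brownian_motion
begin

lemma B_gaussian: "0 \<le> u \<Longrightarrow> gaussian_rv M (B u)"
  using gaussian unfolding gaussian_process_def
  by (drule_tac spec2[of _ "{u}" "\<lambda>_. 1"]) simp

lemma B_measurable: "0 \<le> u \<Longrightarrow> B u \<in> borel_measurable M"
  using B_gaussian by (simp add: gaussian_rv_def)

lemma increment_gaussian:
  assumes "0 \<le> u" "0 \<le> v"
  shows "gaussian_rv M (\<lambda>\<omega>. B u \<omega> - B v \<omega>)"
\<comment> \<open>For \<open>u = v\<close> the set \<open>{u, v}\<close> collapses and cannot carry
  the two coefficients 1 and -1; the zero variable is then the empty linear combination.\<close>
proof (cases "u = v")
  case True
  then show ?thesis
    using gaussian unfolding gaussian_process_def
    by (drule_tac spec2[of _ "{}" "\<lambda>_. 1"]) simp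
next
  case False
  then show ?thesis
    using assms gaussian unfolding gaussian_process_def
    by (drule_tac spec2[of _ "{u, v}" "\<lambda>i. if i = u then 1 else - 1"]) simp
qed

text \<open>Polarisation: \<open>B u * B v\<close> is half of
  \<open>(B u)^2 + (B v)^2 - (B u - B v)^2\<close>, and the covariance at the three pairs formed
  from \<open>u\<close> and \<open>v\<close> yields the remaining moment.\<close>

lemma increment_second_moment:
  assumes "0 \<le> u" "0 \<le> v"
  shows "expectation (\<lambda>\<omega>. (B u \<omega> - B v \<omega>)\<^sup>2) = \<bar>u - v\<bar> powr (2 * H)"
proof -
  note sq = gaussian_rv_square_integrable[OF B_gaussian[OF assms(1)]]
    gaussian_rv_square_integrable[OF B_gaussian[OF assms(2)]]
    gaussian_rv_square_integrable[OF increment_gaussian[OF assms]]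
  have p: "(\<lambda>\<omega>. B u \<omega> * B v \<omega>) = (\<lambda>\<omega>. ((B u \<omega>)\<^sup>2 + (B v \<omega>)\<^sup>2 - (B u \<omega> - B v \<omega>)\<^sup>2) / 2)"
    by (auto simp: fun_eq_iff power2_eq_square algebra_simps)
  have "expectation (\<lambda>\<omega>. B u \<omega> * B v \<omega>)
    = (expectation (\<lambda>\<omega>. (B u \<omega>)\<^sup>2) + expectation (\<lambda>\<omega>. (B v \<omega>)\<^sup>2) - expectation (\<lambda>\<omega>. (B u \<omega> - B v \<omega>)\<^sup>2)) / 2"
    unfolding p using sq by simp
  then show ?thesis
    using covariance[OF assms(2) assms(1)] covariance[OF assms(1) assms(1)] covariance[OF assms(2) assms(2)]
    by (simp add: power2_eq_square)
qed

lemma increment_distributed: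
  assumes "0 \<le> u" "0 \<le> v" "u \<noteq> v"
  shows "distributed M lborel (\<lambda>\<omega>. B u \<omega> - B v \<omega>) (normal_density 0 (\<bar>u - v\<bar> powr H))"
proof (rule gaussian_rv_centered_distributed)
  show "expectation (\<lambda>\<omega>. B u \<omega> - B v \<omega>) = 0"
    using assms centered gaussian_rv_integrable[OF B_gaussian] by simp
  show "expectation (\<lambda>\<omega>. (B u \<omega> - B v \<omega>)\<^sup>2) = (\<bar>u - v\<bar> powr H)\<^sup>2"
    using assms by (simp add: increment_second_moment powr_realpow[symmetric] powr_powr mult.commute)
qed (use assms increment_gaussian in auto)

lemma increment_prob_eq:
  assumes "0 \<le> u" "0 \<le> v" "u \<noteq> v"
  shows "prob {\<omega> \<in> space M. y < B u \<omega> - B v \<omega>}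
    = measure (density lborel (normal_density 0 (\<bar>u - v\<bar> powr H))) {y<..}"
proof -
  note D = increment_distributed[OF assms]
  have m: "(\<lambda>\<omega>. B u \<omega> - B v \<omega>) \<in> measurable M lborel"
    using D by (simp add: distributed_def)
  have "measure (density lborel (normal_density 0 (\<bar>u - v\<bar> powr H))) {y<..}
    = measure (distr M lborel (\<lambda>\<omega>. B u \<omega> - B v \<omega>)) {y<..}"
    using D by (simp add: distributed_def)
  also have "\<dots> = prob ((\<lambda>\<omega>. B u \<omega> - B v \<omega>) -` {y<..} \<inter> space M)"
    using m by (intro measure_distr) auto
  also have "(\<lambda>\<omega>. B u \<omega> - B v \<omega>) -` {y<..} \<inter> space M = {\<omega> \<in> space M. y < B u \<omega> - B v \<omega>}"
    by auto
  finally show ?thesis ..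
qed

text \<open>The variance grows with the lag, so a bound \<open>d\<close> on the lag gives one
  estimate for all pairs of grid points. A null increment has no density, but then the event is
  empty as \<open>y\<close> is nonnegative.\<close>

lemma increment_tail:
  assumes "0 \<le> u" "0 \<le> v" "0 \<le> y" "\<bar>u - v\<bar> \<le> d"
  shows "prob {\<omega> \<in> space M. y < B u \<omega> - B v \<omega>} \<le> exp (- y\<^sup>2 / (2 * d powr (2 * H)))"
proof (cases "u = v")
  case True
  then have none: "{\<omega> \<in> space M. y < B u \<omega> - B v \<omega>} = {}" using assms by auto
  show ?thesis unfolding none by simp
next
  case False
  have sq: "(\<bar>u - v\<bar> powr H)\<^sup>2 = \<bar>u - v\<bar> powr (2 * H)"
    using False by (simp add: powr_realpow[symmetric] powr_powr mult.commute)
  have "\<bar>u - v\<bar> powr (2 * H) \<le> d powr (2 * H)"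
    using assms Hurst_pos by (intro powr_mono2) auto
  moreover have "0 < \<bar>u - v\<bar> powr (2 * H)" using False by simp
  ultimately have "- y\<^sup>2 / (2 * \<bar>u - v\<bar> powr (2 * H)) \<le> - y\<^sup>2 / (2 * d powr (2 * H))"
    by (simp add: frac_le)
  moreover have "prob {\<omega> \<in> space M. y < B u \<omega> - B v \<omega>} \<le> exp (- y\<^sup>2 / (2 * \<bar>u - v\<bar> powr (2 * H)))"
    using normal_upper_tail_le[of "\<bar>u - v\<bar> powr H" y] False assms
    by (simp add: increment_prob_eq sq)
  ultimately show ?thesis by (meson exp_le_cancel_iff order_trans)
qed

lemma abs_increment_tail:
  assumes "0 \<le> u" "0 \<le> v" "0 \<le> y" "\<bar>u - v\<bar> \<le> d"
  shows "prob {\<omega> \<in> space M. y < \<bar>B u \<omega> - B v \<omega>\<bar>} \<le> 2 * exp (- y\<^sup>2 / (2 * d powr (2 * H)))"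
proof -
  have [measurable]: "B u \<in> borel_measurable M" "B v \<in> borel_measurable M"
    using assms by (auto intro: B_measurable)
  have "{\<omega> \<in> space M. y < \<bar>B u \<omega> - B v \<omega>\<bar>}
    = {\<omega> \<in> space M. y < B u \<omega> - B v \<omega>} \<union> {\<omega> \<in> space M. y < B v \<omega> - B u \<omega>}"
    by auto
  also have "prob \<dots> \<le> prob {\<omega> \<in> space M. y < B u \<omega> - B v \<omega>} + prob {\<omega> \<in> space M. y < B v \<omega> - B u \<omega>}"
    by (intro measure_Un_le) measurable
  also have "\<dots> \<le> 2 * exp (- y\<^sup>2 / (2 * d powr (2 * H)))"
    using increment_tail[of u v y d] increment_tail[of v u y d] assms by (simp add: abs_minus_commute)
  finally show ?thesis .
qed

end

section \<open>Dyadic grids and chaining along a continuous path\<close>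

definition dyadic_point :: "real \<Rightarrow> nat \<Rightarrow> nat \<Rightarrow> real" where
  "dyadic_point t k i = t * real i / 2 ^ k"

text \<open>Rounding down preserves the order of \<open>u\<close> and \<open>v\<close>, keeps points
  of \<open>[0, t]\<close> on the grid, and makes refinement amount to reading one more binary digit
  of \<open>u / t\<close>.\<close>

definition dyadic_index :: "real \<Rightarrow> nat \<Rightarrow> real \<Rightarrow> nat" where
  "dyadic_index t k u = nat \<lfloor>u * 2 ^ k / t\<rfloor>"

lemma dyadic_index_bounds:
  assumes "0 < t" "0 \<le> u"
  shows "dyadic_point t k (dyadic_index t k u) \<le> u"
    and "u - t / 2 ^ k \<le> dyadic_point t k (dyadic_index t k u)"
proof -
  have "real (dyadic_index t k u) = of_int \<lfloor>u * 2 ^ k / t\<rfloor>"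
    using assms by (simp add: dyadic_index_def)
  then have "real (dyadic_index t k u) \<le> u * 2 ^ k / t" "u * 2 ^ k / t - 1 \<le> real (dyadic_index t k u)"
    by linarith+
  moreover have "u - t / 2 ^ k = t * (u * 2 ^ k / t - 1) / 2 ^ k" "u = t * (u * 2 ^ k / t) / 2 ^ k"
    using assms by (auto simp: field_simps)
  ultimately show "dyadic_point t k (dyadic_index t k u) \<le> u"
    "u - t / 2 ^ k \<le> dyadic_point t k (dyadic_index t k u)"
    unfolding dyadic_point_def using assms
    by (metis divide_right_mono less_eq_real_def mult_left_mono zero_le_numeral zero_le_power)+
qed

lemma dyadic_index_mono: "0 < t \<Longrightarrow> u \<le> v \<Longrightarrow> dyadic_index t k u \<le> dyadic_index t k v"
  unfolding dyadic_index_def by (intro nat_mono floor_mono divide_right_mono mult_right_mono) auto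

lemma dyadic_index_le: "0 < t \<Longrightarrow> u \<le> t \<Longrightarrow> dyadic_index t k u \<le> 2 ^ k"
  using dyadic_index_mono[of t u t k] by (simp add: dyadic_index_def nat_power_eq)

lemma dyadic_point_in: "0 < t \<Longrightarrow> i \<le> 2 ^ k \<Longrightarrow> dyadic_point t k i \<in> {0..t}"
  by (simp add: dyadic_point_def divide_le_eq)

text \<open>Doubling a real number doubles its floor, or doubles it and adds one.\<close>

lemma dyadic_index_Suc:
  assumes "0 < t" "0 \<le> u"
  shows "dyadic_index t (Suc k) u = 2 * dyadic_index t k u \<or> dyadic_index t (Suc k) u = Suc (2 * dyadic_index t k u)"
proof -
  define z where "z = u * 2 ^ k / t"
  have "z \<ge> 0" using assms by (simp add: z_def)
  have "dyadic_index t (Suc k) u = nat \<lfloor>2 * z\<rfloor>" "dyadic_index t k u = nat \<lfloor>z\<rfloor>"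
    by (simp_all add: dyadic_index_def z_def mult.left_commute)
  moreover have "\<lfloor>2 * z\<rfloor> = 2 * \<lfloor>z\<rfloor> \<or> \<lfloor>2 * z\<rfloor> = 2 * \<lfloor>z\<rfloor> + 1" by linarith
  moreover have "\<lfloor>z\<rfloor> \<ge> 0" using \<open>z \<ge> 0\<close> by simp
  ultimately show ?thesis by linarith
qed

lemma dyadic_point_double: "dyadic_point t (Suc k) (2 * i) = dyadic_point t k i"
  by (simp add: dyadic_point_def)

lemma dyadic_approx_tendsto:
  assumes "0 < t" "0 \<le> u" "u \<le> t" "continuous_on {0..t} f"
  shows "(\<lambda>k. f (dyadic_point t k (dyadic_index t k u))) \<longlonglongrightarrow> f u"
proof (rule continuous_on_tendsto_compose[OF assms(4)])
  have "(\<lambda>k. u - t / 2 ^ k) \<longlonglongrightarrow> u" by real_asymp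
  then show "(\<lambda>k. dyadic_point t k (dyadic_index t k u)) \<longlonglongrightarrow> u"
    by (rule tendsto_sandwich[rotated 2, OF _ tendsto_const]) (use dyadic_index_bounds assms in auto)
qed (use assms dyadic_point_in dyadic_index_le in auto)

text \<open>Telescope along the approximations of \<open>u\<close> at levels \<open>m\<close>,
  \<open>m + 1\<close>, and so on: each refinement either leaves the point fixed or crosses one
  interval of the finer grid. Continuity carries the bound over to the limit
  \<open>u\<close>.\<close>

lemma dyadic_chaining:
  fixes f :: "real \<Rightarrow> real"
  assumes t: "0 < t" and u: "0 \<le> u" "u \<le> t" and f: "continuous_on {0..t} f"
    and b: "summable b" "\<And>k. 0 \<le> b k"
    and incr: "\<And>k j. j < 2 ^ Suc (k + m) \<Longrightarrow>
      \<bar>f (dyadic_point t (Suc (k + m)) (Suc j)) - f (dyadic_point t (Suc (k + m)) j)\<bar> \<le> b k"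
  shows "\<bar>f u - f (dyadic_point t m (dyadic_index t m u))\<bar> \<le> suminf b"
proof -
  define g where "g k = f (dyadic_point t k (dyadic_index t k u))" for k
  have step: "\<bar>g (Suc (k + m)) - g (k + m)\<bar> \<le> b k" for k
  proof -
    \<comment> \<open>If the new digit is 1, the finer index is the successor of
      \<open>j = 2 * dyadic_index t (k + m) u\<close>. As it is at most
      \<open>2 ^ Suc (k + m)\<close>, this \<open>j\<close> is strictly smaller and
      \<open>incr\<close> applies.\<close>
    have "dyadic_index t (Suc (k + m)) u \<le> 2 ^ Suc (k + m)"
      using t u(2) by (rule dyadic_index_le)
    then show ?thesis
      using dyadic_index_Suc[OF t u(1), of "k + m"] incr[of "2 * dyadic_index t (k + m) u" k] b(2)[of k]
      unfolding g_def dyadic_point_double[of t "k + m", symmetric] by auto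
  qed
  have "\<bar>g (n + m) - g m\<bar> \<le> sum b {..<n}" for n
  proof (induction n)
    case (Suc n)
    then show ?case using step[of n] by simp
  qed simp
  also have "sum b {..<n} \<le> suminf b" for n
    using b by (intro sum_le_suminf) auto
  finally have "\<bar>g (n + m) - g m\<bar> \<le> suminf b" for n .
  moreover have "(\<lambda>n. \<bar>g (n + m) - g m\<bar>) \<longlonglongrightarrow> \<bar>f u - g m\<bar>"
    using dyadic_approx_tendsto[OF t u f] unfolding g_def
    by (intro tendsto_intros LIMSEQ_ignore_initial_segment)
  ultimately show ?thesis
    unfolding g_def by (intro LIMSEQ_le_const2) auto
qed


text \<open>The doubly exponential decay beats the number of increments. The factor
  \<open>2 ^ (k + 2)\<close> stands for the \<open>2 ^ (k + 1)\<close> increments of level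
  \<open>k + 1\<close>, each with two signs.\<close>

lemma summable_dyadic_gaussian_tails:
  fixes q a :: real
  assumes "1 < q" "0 < a"
  shows "summable (\<lambda>k. 2 ^ (k + 2) * exp (- (q ^ k - 1) / a))"
proof (rule summable_comparison_test_ev)
  have "eventually (\<lambda>k. 2 ^ (k + 2) * exp (- (q ^ k - 1) / a) \<le> (1 / 2) ^ k) at_top"
    using assms by real_asymp
  then show "eventually (\<lambda>k. norm (2 ^ (k + 2) * exp (- (q ^ k - 1) / a)) \<le> (1 / 2) ^ k) at_top"
    by simp
  show "summable (\<lambda>k. (1 / 2) ^ k :: real)"
    by (intro summable_geometric) simp
qed

section \<open>Measurability and tail bounds of the maximum loss\<close>

context fractional_brownian_motion
begin

lemma path_continuous: "\<omega> \<in> space M \<Longrightarrow> continuous_on {0..t} (\<lambda>u. B u \<omega>)"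
  by (rule continuous_on_subset[OF continuous_paths]) auto

text \<open>By compactness the path is bounded on \<open>{0..t}\<close>, so the real
  \<open>SUP\<close> is a genuine supremum and exceeds \<open>x\<close> exactly when some element
  does.\<close>

lemma maximum_loss_gt_iff:
  assumes t: "0 < t" and \<omega>: "\<omega> \<in> space M"
  shows "x < maximum_loss B t \<omega> \<longleftrightarrow> (\<exists>u v. 0 \<le> u \<and> u \<le> v \<and> v \<le> t \<and> x < B u \<omega> - B v \<omega>)"
proof -
  have "bounded ((\<lambda>u. B u \<omega>) ` {0..t})"
    by (intro compact_imp_bounded compact_continuous_image path_continuous \<omega>) auto
  then obtain K where K: "\<And>u. u \<in> {0..t} \<Longrightarrow> \<bar>B u \<omega>\<bar> \<le> K"
    by (auto simp only: bounded_iff ball_simps real_norm_def)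
  have "bdd_above ((\<lambda>(u, v). B u \<omega> - B v \<omega>) ` {(u, v). 0 \<le> u \<and> u \<le> v \<and> v \<le> t})"
  proof (rule bdd_aboveI2)
    fix p assume "p \<in> {(u, v). 0 \<le> u \<and> u \<le> v \<and> v \<le> t}"
    then show "(case p of (u, v) \<Rightarrow> B u \<omega> - B v \<omega>) \<le> 2 * K"
      using K[of "fst p"] K[of "snd p"] by (auto simp: case_prod_beta)
  qed
  moreover have "{(u, v). 0 \<le> u \<and> u \<le> v \<and> v \<le> t} \<noteq> {}"
    using t by (auto intro!: exI[of _ t])
  ultimately show ?thesis
    unfolding maximum_loss_def by (subst less_cSUP_iff) auto
qed

text \<open>The strict inequality survives a small move of \<open>u\<close> and \<open>v\<close> to
  grid points, and rounding down keeps their order. Countably many pairs of times therefore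
  suffice.\<close>

lemma maximum_loss_gt_iff_dyadic:
  assumes t: "0 < t" and \<omega>: "\<omega> \<in> space M"
  shows "x < maximum_loss B t \<omega> \<longleftrightarrow>
    (\<exists>k. \<exists>j\<le>2 ^ k. \<exists>i\<le>j. x < B (dyadic_point t k i) \<omega> - B (dyadic_point t k j) \<omega>)"
proof
  assume "x < maximum_loss B t \<omega>"
  then obtain u v where uv: "0 \<le> u" "u \<le> v" "v \<le> t" "x < B u \<omega> - B v \<omega>"
    using maximum_loss_gt_iff[OF t \<omega>] by blast
  have "(\<lambda>k. B (dyadic_point t k (dyadic_index t k u)) \<omega> - B (dyadic_point t k (dyadic_index t k v)) \<omega>)
      \<longlonglongrightarrow> B u \<omega> - B v \<omega>"
    using t uv by (intro tendsto_diff dyadic_approx_tendsto path_continuous \<omega>) auto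
  from order_tendstoD(1)[OF this uv(4)] obtain k where
    "x < B (dyadic_point t k (dyadic_index t k u)) \<omega> - B (dyadic_point t k (dyadic_index t k v)) \<omega>"
    by (auto simp: eventually_sequentially)
  then show "\<exists>k. \<exists>j\<le>2 ^ k. \<exists>i\<le>j. x < B (dyadic_point t k i) \<omega> - B (dyadic_point t k j) \<omega>"
    using dyadic_index_le[OF t uv(3)] dyadic_index_mono[OF t uv(2)] by blast
next
  assume "\<exists>k. \<exists>j\<le>2 ^ k. \<exists>i\<le>j. x < B (dyadic_point t k i) \<omega> - B (dyadic_point t k j) \<omega>"
  then obtain k i j where ij: "j \<le> 2 ^ k" "i \<le> j"
    and gt: "x < B (dyadic_point t k i) \<omega> - B (dyadic_point t k j) \<omega>"
    by blast
  have "dyadic_point t k i \<le> dyadic_point t k j"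
    using t ij by (simp add: dyadic_point_def divide_right_mono)
  then show "x < maximum_loss B t \<omega>"
    using dyadic_point_in[OF t, of i k] dyadic_point_in[OF t, of j k] ij gt
    unfolding maximum_loss_gt_iff[OF t \<omega>] by force
qed

text \<open>Measurability follows from the countable dyadic description; it is what lets the lower
  bound compare probabilities by inclusion.\<close>

lemma maximum_loss_event:
  assumes "0 < t"
  shows "{\<omega> \<in> space M. x < maximum_loss B t \<omega>} \<in> events"
proof -
  have [measurable]: "B (dyadic_point t k i) \<in> borel_measurable M" for k i
    using assms by (intro B_measurable) (simp add: dyadic_point_def)
  have "{\<omega> \<in> space M. x < maximum_loss B t \<omega>} =
    {\<omega> \<in> space M. \<exists>k. \<exists>j\<in>{..2 ^ k}. \<exists>i\<in>{..j}. x < B (dyadic_point t k i) \<omega> - B (dyadic_point t k j) \<omega>}"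
    by (intro Collect_cong conj_cong refl) (simp add: maximum_loss_gt_iff_dyadic[OF assms] Bex_def)
  also have "\<dots> \<in> events" by measurable
  finally show ?thesis .
qed

lemma maximum_loss_prob_ge:
  assumes t: "0 < t" and x: "0 \<le> x"
  shows "normal_density 0 (t powr H) (x + 1) \<le> prob {\<omega> \<in> space M. x < maximum_loss B t \<omega>}"
proof -
  have "normal_density 0 (t powr H) (x + 1) \<le> prob {\<omega> \<in> space M. x < B 0 \<omega> - B t \<omega>}"
    using normal_upper_tail_ge[of "t powr H" x] t x by (simp add: increment_prob_eq)
  also have "\<dots> \<le> prob {\<omega> \<in> space M. x < maximum_loss B t \<omega>}"
  proof (intro finite_measure_mono maximum_loss_event subsetI)
    fix \<omega> assume "\<omega> \<in> {\<omega> \<in> space M. x < B 0 \<omega> - B t \<omega>}"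
    then have "\<omega> \<in> space M" "0 \<le> (0::real) \<and> 0 \<le> t \<and> t \<le> t \<and> x < B 0 \<omega> - B t \<omega>"
      using t by auto
    then show "\<omega> \<in> {\<omega> \<in> space M. x < maximum_loss B t \<omega>}"
      using maximum_loss_gt_iff[OF t] by blast
  qed (use t in auto)
  finally show ?thesis .
qed

text \<open>The squared threshold carries the factor \<open>2 powr (- H * k)\<close>, the variance
  at most \<open>t powr (2 * H) * 2 powr (- 2 * H * k)\<close>. Their ratio grows like
  \<open>(2 powr H) ^ k\<close>, which leaves a summable factor beside the Gaussian term in
  \<open>x\<close>.\<close>

lemma dyadic_increment_tail:
  assumes t: "0 < t" and x: "1 \<le> x"
  shows "prob {\<omega> \<in> space M. x * (2 powr (- H / 2)) ^ k <
      \<bar>B (dyadic_point t (Suc k) (Suc j)) \<omega> - B (dyadic_point t (Suc k) j) \<omega>\<bar>}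
    \<le> 2 * (exp (- x\<^sup>2 / (2 * t powr (2 * H))) * exp (- ((2 powr H) ^ k - 1) / (2 * t powr (2 * H))))"
proof -
  define T d y Q where "T = t powr (2 * H)" and "d = t / 2 ^ Suc k"
    and "y = x * (2 powr (- H / 2)) ^ k" and "Q = (2 powr H) ^ k"
  have T: "T > 0" and d: "d powr (2 * H) > 0" using t by (simp_all add: T_def d_def)
  have Q: "Q \<ge> 1"
    using Hurst_pos by (simp add: Q_def ge_one_powr_ge_zero)
  have "d powr (2 * H) = T * 2 powr (- (2 * H * Suc k))"
    using t unfolding d_def T_def
    by (subst powr_divide) (auto simp: powr_minus divide_inverse powr_powr powr_realpow[symmetric] mult_ac simp del: power_Suc)
  \<comment> \<open>The factor \<open>2 powr (- 2 * H)\<close> due to \<open>Suc k\<close> is given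
    away.\<close>
  also have "\<dots> \<le> T * 2 powr (- (2 * H * k))"
    using T Hurst_pos by (intro mult_left_mono powr_mono) auto
  finally have dle: "d powr (2 * H) * Q \<le> T * 2 powr (- (2 * H * k)) * Q"
    using Q by (intro mult_right_mono) auto
  also have "\<dots> = T * 2 powr (- (H * k))"
    by (simp add: Q_def powr_realpow[symmetric] powr_powr powr_add[symmetric] mult_ac)
  also have "\<dots> = T * ((2 powr (- H / 2)) ^ k)\<^sup>2"
    by (simp add: powr_realpow[symmetric] powr_powr mult_ac)
  finally have "x\<^sup>2 * (d powr (2 * H) * Q) \<le> x\<^sup>2 * (T * ((2 powr (- H / 2)) ^ k)\<^sup>2)"
    by (intro mult_left_mono) auto
  then have "(x\<^sup>2 * Q) * d powr (2 * H) \<le> y\<^sup>2 * T"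
    by (simp add: y_def power_mult_distrib mult_ac)
  then have le1: "(x\<^sup>2 * Q) / (2 * T) \<le> y\<^sup>2 / (2 * d powr (2 * H))"
    using T d by (simp add: field_simps)
  \<comment> \<open>Separates \<open>x\<close> from the level: for \<open>x \<ge> 1\<close> and
    \<open>Q \<ge> 1\<close> the product \<open>x^2 * Q\<close> dominates
    \<open>x^2 + (Q - 1)\<close>, so the exponential factors.\<close>
  have "x\<^sup>2 \<ge> 1" using x by simp
  then have "0 \<le> (x\<^sup>2 - 1) * (Q - 1)" using Q by simp
  then have "x\<^sup>2 + (Q - 1) \<le> x\<^sup>2 * Q" by (simp add: algebra_simps)
  then have "(x\<^sup>2 + (Q - 1)) / (2 * T) \<le> (x\<^sup>2 * Q) / (2 * T)"
    using T by (intro divide_right_mono) auto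
  with le1 have le: "- y\<^sup>2 / (2 * d powr (2 * H)) \<le> - x\<^sup>2 / (2 * T) + - (Q - 1) / (2 * T)"
    by (simp add: add_divide_distrib diff_divide_distrib)
  have "prob {\<omega> \<in> space M. y <
      \<bar>B (dyadic_point t (Suc k) (Suc j)) \<omega> - B (dyadic_point t (Suc k) j) \<omega>\<bar>}
    \<le> 2 * exp (- y\<^sup>2 / (2 * d powr (2 * H)))"
  proof (rule abs_increment_tail)
    have "dyadic_point t (Suc k) (Suc j) - dyadic_point t (Suc k) j = d"
      by (simp add: dyadic_point_def d_def field_simps)
    then show "\<bar>dyadic_point t (Suc k) (Suc j) - dyadic_point t (Suc k) j\<bar> \<le> d"
      using t by (simp add: d_def)
  qed (use t x in \<open>auto simp: dyadic_point_def y_def\<close>)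
  also have "\<dots> \<le> 2 * (exp (- x\<^sup>2 / (2 * T)) * exp (- (Q - 1) / (2 * T)))"
    unfolding exp_add[symmetric] using le by simp
  finally show ?thesis
    by (simp only: y_def T_def Q_def)
qed

text \<open>The constant \<open>K\<close> depends on \<open>\<delta>\<close> but not on
  \<open>x\<close>, so its logarithm is negligible against \<open>x^2\<close>.\<close>

lemma maximum_loss_prob_le:
  assumes t: "0 < t" and \<delta>: "0 < \<delta>" "\<delta> < 1"
  obtains K where "0 < K" and "\<And>x. 1 \<le> x \<Longrightarrow>
    prob {\<omega> \<in> space M. x < maximum_loss B t \<omega>} \<le> K * exp (- ((1 - \<delta>) * x)\<^sup>2 / (2 * t powr (2 * H)))"
proof -
  define r Q T where "r = 2 powr (- H / 2)" and "Q = 2 powr H" and "T = t powr (2 * H)"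
  define c where "c k = 2 ^ (k + 2) * exp (- (Q ^ k - 1) / (2 * T))" for k :: nat
  have T: "T > 0" using t by (simp add: T_def)
  have r: "0 < r" "r < 1"
    using Hurst_pos powr_less_mono[of "- H / 2" 0 2] by (simp_all add: r_def)
  have "Q > 1" using Hurst_pos powr_less_mono[of 0 H 2] by (simp add: Q_def)
  then have c: "summable c"
    unfolding c_def using T by (intro summable_dyadic_gaussian_tails) auto
  have c0: "0 \<le> c k" for k by (simp add: c_def)
  \<comment> \<open>Chaining from level \<open>m\<close> costs \<open>x\<close> times this geometric
    tail. The level is chosen from \<open>\<delta>\<close> alone, which keeps the coarse grid fixed
    while \<open>x\<close> varies.\<close>
  have "(\<lambda>m. r ^ m / (1 - r)) \<longlonglongrightarrow> 0 / (1 - r)"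
    using r by (intro tendsto_intros LIMSEQ_power_zero) auto
  from order_tendstoD(2)[OF this, of "\<delta> / 2"] \<delta> obtain m where m: "r ^ m / (1 - r) < \<delta> / 2"
    by (auto simp: eventually_sequentially)
  have r_sums: "(\<lambda>n. r ^ (n + m)) sums (r ^ m / (1 - r))"
    using sums_mult[OF geometric_sums[of r], of "r ^ m"] r by (simp add: power_add mult_ac)
  \<comment> \<open>One term for each pair of coarse grid points, plus the series for all finer
    levels.\<close>
  define K where "K = real (card ({..2 ^ m} \<times> {..2 ^ m} :: (nat \<times> nat) set)) + (\<Sum>n. c (n + m))"
  have "0 \<le> (\<Sum>n. c (n + m))"
    using c c0 by (intro suminf_nonneg) (auto simp: summable_iff_shift)
  then have K: "0 < K" unfolding K_def by (simp add: add_pos_nonneg)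
  have B_meas[measurable]: "B (dyadic_point t k i) \<in> borel_measurable M" for k i
    using t by (intro B_measurable) (simp add: dyadic_point_def)
  show thesis
  proof (rule that[OF K])
    fix x :: real assume x: "1 \<le> x"
    \<comment> \<open>\<open>F\<close> is a large coarse increment, \<open>G\<close> an increment of
      level \<open>n + m + 1\<close> above its allowance, and \<open>A n\<close> the event that this
      occurs somewhere on that level.\<close>
    define F where "F p = {\<omega> \<in> space M. (1 - \<delta>) * x <
      B (dyadic_point t m (fst p)) \<omega> - B (dyadic_point t m (snd p)) \<omega>}" for p
    define G where "G n j = {\<omega> \<in> space M. x * r ^ (n + m) <
      \<bar>B (dyadic_point t (Suc (n + m)) (Suc j)) \<omega> - B (dyadic_point t (Suc (n + m)) j) \<omega>\<bar>}" for n j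
    define I where "I = ({..2 ^ m} \<times> {..2 ^ m} :: (nat \<times> nat) set)"
    define A where "A n = (\<Union>j<2 ^ Suc (n + m). G n j)" for n
    define e where "e = exp (- ((1 - \<delta>) * x)\<^sup>2 / (2 * T))"
    have F_ev: "F p \<in> events" for p
      unfolding F_def by measurable
    have G_ev: "G n j \<in> events" for n j
      unfolding G_def by measurable
    have A_ev: "A n \<in> events" for n
      unfolding A_def using G_ev by auto
    have I: "finite I" by (simp add: I_def)
    have sub: "{\<omega> \<in> space M. x < maximum_loss B t \<omega>} \<subseteq> (\<Union>p\<in>I. F p) \<union> (\<Union>n. A n)"
    proof
      fix \<omega> assume "\<omega> \<in> {\<omega> \<in> space M. x < maximum_loss B t \<omega>}"
      then have \<omega>: "\<omega> \<in> space M" and "x < maximum_loss B t \<omega>" by auto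
      then obtain u v where uv: "0 \<le> u" "u \<le> v" "v \<le> t" "x < B u \<omega> - B v \<omega>"
        using maximum_loss_gt_iff[OF t] by blast
      show "\<omega> \<in> (\<Union>p\<in>I. F p) \<union> (\<Union>n. A n)"
      proof (cases "\<omega> \<in> (\<Union>n. A n)")
        case False
        have near: "\<bar>B w \<omega> - B (dyadic_point t m (dyadic_index t m w)) \<omega>\<bar> \<le> x * (r ^ m / (1 - r))"
          if w: "0 \<le> w" "w \<le> t" for w
        proof -
          have "\<bar>B w \<omega> - B (dyadic_point t m (dyadic_index t m w)) \<omega>\<bar> \<le> (\<Sum>n. x * r ^ (n + m))"
          proof (rule dyadic_chaining[OF t w path_continuous[OF \<omega>]])
            show "summable (\<lambda>n. x * r ^ (n + m))"
              using r_sums by (intro summable_mult) (rule sums_summable)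
            show "0 \<le> x * r ^ (k + m)" for k using x r by simp
            show "\<bar>B (dyadic_point t (Suc (k + m)) (Suc j)) \<omega> - B (dyadic_point t (Suc (k + m)) j) \<omega>\<bar>
                \<le> x * r ^ (k + m)" if "j < 2 ^ Suc (k + m)" for k j
              using False \<omega> that by (force simp: A_def G_def not_less)
          qed
          also have "\<dots> = x * (r ^ m / (1 - r))"
            using sums_mult[OF r_sums, of x] by (simp add: sums_unique[symmetric])
          finally show ?thesis .
        qed
        \<comment> \<open>Moving \<open>u\<close> and \<open>v\<close> to the coarse grid costs at
          most \<open>x * (\<delta> / 2)\<close> each, so a loss above
          \<open>(1 - \<delta>) * x\<close> remains.\<close>
        have "x * (r ^ m / (1 - r)) \<le> x * (\<delta> / 2)"
          using m x by (intro mult_left_mono) auto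
        moreover have "(1 - \<delta>) * x = x - 2 * (x * (\<delta> / 2))"
          by (simp add: algebra_simps)
        moreover note near[of u] near[of v]
        ultimately have "(1 - \<delta>) * x < B (dyadic_point t m (dyadic_index t m u)) \<omega> - B (dyadic_point t m (dyadic_index t m v)) \<omega>"
          using uv by linarith
        moreover have "(dyadic_index t m u, dyadic_index t m v) \<in> I"
          using uv dyadic_index_le[OF t, of _ m] by (simp add: I_def)
        ultimately show ?thesis
          using \<omega> by (force simp: F_def)
      qed auto
    qed
    have F_le: "prob (F p) \<le> e" if "p \<in> I" for p
      unfolding F_def e_def T_def
    proof (rule increment_tail)
      have "dyadic_point t m (fst p) \<in> {0..t}" "dyadic_point t m (snd p) \<in> {0..t}"
        using that by (auto simp: I_def intro!: dyadic_point_in[OF t, simplified])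
      then show "0 \<le> dyadic_point t m (fst p)" "0 \<le> dyadic_point t m (snd p)"
        "\<bar>dyadic_point t m (fst p) - dyadic_point t m (snd p)\<bar> \<le> t"
        by auto
    qed (use \<delta> x in auto)
    \<comment> \<open>The chaining failures have the full exponent \<open>x^2\<close>, so they too
      can be charged to the weaker bound \<open>e\<close>.\<close>
    have e_ge: "exp (- x\<^sup>2 / (2 * T)) \<le> e"
    proof -
      have "((1 - \<delta>) * x)\<^sup>2 \<le> x\<^sup>2"
        using \<delta> x by (intro power_mono) (auto simp: mult_le_cancel_right1)
      then show ?thesis
        unfolding e_def using T by (simp add: divide_right_mono)
    qed
    have A_le: "prob (A n) \<le> c (n + m) * e" for n
    proof -
      have "prob (A n) \<le> (\<Sum>j<2 ^ Suc (n + m). prob (G n j))"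
        unfolding A_def using G_ev by (intro finite_measure_subadditive_finite) auto
      also have "\<dots> \<le> (\<Sum>j<(2::nat) ^ Suc (n + m). 2 * (e * exp (- (Q ^ (n + m) - 1) / (2 * T))))"
      proof (intro sum_mono)
        fix j
        have "prob (G n j) \<le> 2 * (exp (- x\<^sup>2 / (2 * T)) * exp (- (Q ^ (n + m) - 1) / (2 * T)))"
          unfolding G_def r_def Q_def T_def by (rule dyadic_increment_tail[OF t x])
        also have "\<dots> \<le> 2 * (e * exp (- (Q ^ (n + m) - 1) / (2 * T)))"
          using e_ge by (intro mult_left_mono mult_right_mono) auto
        finally show "prob (G n j) \<le> 2 * (e * exp (- (Q ^ (n + m) - 1) / (2 * T)))" .
      qed
      also have "\<dots> = c (n + m) * e"
        by (simp add: c_def)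
      finally show ?thesis .
    qed
    have c_shift: "summable (\<lambda>n. c (n + m) * e)"
      using c by (intro summable_mult2) (simp add: summable_iff_shift)
    \<comment> \<open>Countable subadditivity with a real-valued series requires this
      summability.\<close>
    then have A_sum: "summable (\<lambda>n. prob (A n))"
      by (rule summable_comparison_test'[where N = 0]) (use A_le in auto)
    have "prob {\<omega> \<in> space M. x < maximum_loss B t \<omega>} \<le> prob ((\<Union>p\<in>I. F p) \<union> (\<Union>n. A n))"
      using sub F_ev A_ev I by (intro finite_measure_mono) auto
    also have "\<dots> \<le> prob (\<Union>p\<in>I. F p) + prob (\<Union>n. A n)"
      using F_ev A_ev I by (intro measure_Un_le) auto
    also have "\<dots> \<le> (\<Sum>p\<in>I. prob (F p)) + (\<Sum>n. prob (A n))"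
      using F_ev A_ev I A_sum
      by (intro add_mono finite_measure_subadditive_finite finite_measure_subadditive_countably) auto
    also have "\<dots> \<le> (\<Sum>p\<in>I. e) + (\<Sum>n. c (n + m) * e)"
      using F_le A_le A_sum c_shift by (intro add_mono sum_mono suminf_le) auto
    also have "(\<Sum>n. c (n + m) * e) = (\<Sum>n. c (n + m)) * e"
      using c by (intro suminf_mult2[symmetric]) (simp add: summable_iff_shift)
    also have "(\<Sum>p\<in>I. e) + \<dots> = K * e"
      by (simp add: K_def I_def distrib_right)
    finally show "prob {\<omega> \<in> space M. x < maximum_loss B t \<omega>} \<le> K * exp (- ((1 - \<delta>) * x)\<^sup>2 / (2 * t powr (2 * H)))"
      by (simp only: e_def T_def)
  qed
qed

end

section \<open>The logarithmic limit from the two tail bounds\<close>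

theorem theorem2:
  fixes M :: "'a measure" and B :: "real \<Rightarrow> 'a \<Rightarrow> real" and H t :: real
  assumes "fractional_brownian_motion M H B"
    and "1 / 2 \<le> H" and "H < 1"
    and "0 < t"
  shows "((\<lambda>x::real. 1 / x\<^sup>2 * ln (measure M {\<omega> \<in> space M. maximum_loss B t \<omega> > x}))
           \<longlongrightarrow> - (1 / (2 * t powr (2 * H)))) at_top"
proof -
  interpret fractional_brownian_motion M H B by fact
  define T s where "T = t powr (2 * H)" and "s = t powr H"
  define p where "p x = prob {\<omega> \<in> space M. maximum_loss B t \<omega> > x}" for x
  have T: "T > 0" and s: "s > 0" and sT: "s\<^sup>2 = T"
    using \<open>0 < t\<close> by (simp_all add: T_def s_def powr_realpow[symmetric] powr_powr mult.commute)
  have p_ge: "1 / sqrt (2 * pi * T) * exp (- (x + 1)\<^sup>2 / (2 * T)) \<le> p x" if "0 \<le> x" for x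
    using maximum_loss_prob_ge[OF \<open>0 < t\<close> that] unfolding p_def normal_density_def sT[symmetric] s_def
    by simp
  \<comment> \<open>Both comparisons of logarithms need this, as \<open>ln\<close> is monotone only
    on positive reals.\<close>
  have p_pos: "0 < p x" if "0 \<le> x" for x
    using T by (intro less_le_trans[OF _ p_ge[OF that]]) simp
  have lower: "\<forall>\<^sub>F x in at_top. a < 1 / x\<^sup>2 * ln (p x)" if "a < - (1 / (2 * T))" for a
  proof -
    define D where "D = sqrt (2 * pi * T)"
    have "D > 0" using T by (simp add: D_def)
    \<comment> \<open>The density prefactor \<open>1 / D\<close> and the shift from \<open>x\<close>
      to \<open>x + 1\<close> both vanish after division by \<open>x^2\<close>.\<close>
    have "((\<lambda>x. 1 / x\<^sup>2 * (- (x + 1)\<^sup>2 / (2 * T) - ln D)) \<longlongrightarrow> - (1 / (2 * T))) at_top"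
    proof -
      have "((\<lambda>x. (x + 1)\<^sup>2 / x\<^sup>2) \<longlongrightarrow> (1::real)) at_top"
        and "((\<lambda>x. 1 / x\<^sup>2) \<longlongrightarrow> (0::real)) at_top"
        by real_asymp+
      then have "((\<lambda>x. - ((x + 1)\<^sup>2 / x\<^sup>2 / (2 * T)) - 1 / x\<^sup>2 * ln D) \<longlongrightarrow> - (1 / (2 * T)) - 0 * ln D) at_top"
        using T by (intro tendsto_intros) auto
      moreover have "- ((x + 1)\<^sup>2 / x\<^sup>2 / (2 * T)) - 1 / x\<^sup>2 * ln D = 1 / x\<^sup>2 * (- (x + 1)\<^sup>2 / (2 * T) - ln D)" for x
        by (simp add: right_diff_distrib)
      ultimately show ?thesis by simp
    qed
    from order_tendstoD(1)[OF this that] eventually_gt_at_top[of 0] show ?thesis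
    proof eventually_elim
      case (elim x)
      have "ln (1 / D * exp (- (x + 1)\<^sup>2 / (2 * T))) \<le> ln (p x)"
        using p_ge[of x] p_pos[of x] elim \<open>D > 0\<close> by (intro ln_mono) (auto simp: D_def)
      then have "- (x + 1)\<^sup>2 / (2 * T) - ln D \<le> ln (p x)"
        using \<open>D > 0\<close> by (simp add: ln_mult ln_div)
      then have "1 / x\<^sup>2 * (- (x + 1)\<^sup>2 / (2 * T) - ln D) \<le> 1 / x\<^sup>2 * ln (p x)"
        by (intro mult_left_mono) auto
      with elim show ?case by linarith
    qed
  qed
  have upper: "\<forall>\<^sub>F x in at_top. 1 / x\<^sup>2 * ln (p x) < a" if "- (1 / (2 * T)) < a" for a
  proof -
    \<comment> \<open>The order of the limits matters: \<open>\<delta>\<close> is first fixed, small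
      enough that the limiting rate is below \<open>a\<close>, and only then does \<open>x\<close>
      tend to infinity, with \<open>K\<close> constant.\<close>
    have "((\<lambda>\<delta>. - (1 - \<delta>)\<^sup>2 / (2 * T)) \<longlongrightarrow> - (1 - 0)\<^sup>2 / (2 * T)) (at_right 0)"
      using T by (intro tendsto_intros) auto
    then have "\<forall>\<^sub>F \<delta> in at_right 0. - (1 - \<delta>)\<^sup>2 / (2 * T) < a"
      using that by (intro order_tendstoD(2)) auto
    moreover have "\<forall>\<^sub>F \<delta> in at_right (0::real). \<delta> \<in> {0<..<1}"
      by (rule eventually_at_right_real) simp
    ultimately have "\<forall>\<^sub>F \<delta> in at_right (0::real). \<delta> \<in> {0<..<1} \<and> - (1 - \<delta>)\<^sup>2 / (2 * T) < a"
      by eventually_elim auto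
    then obtain \<delta> where \<delta>: "0 < \<delta>" "\<delta> < 1" and a: "- (1 - \<delta>)\<^sup>2 / (2 * T) < a"
      using eventually_happens[of _ "at_right (0::real)"] by (auto simp: trivial_limit_at_right_real)
    obtain K where K: "0 < K" and p_le: "\<And>x. 1 \<le> x \<Longrightarrow> p x \<le> K * exp (- ((1 - \<delta>) * x)\<^sup>2 / (2 * T))"
      using maximum_loss_prob_le[OF \<open>0 < t\<close> \<delta>] unfolding p_def T_def by blast
    have "((\<lambda>x. 1 / x\<^sup>2 * ln K + - (1 - \<delta>)\<^sup>2 / (2 * T)) \<longlongrightarrow> 0 * ln K + - (1 - \<delta>)\<^sup>2 / (2 * T)) at_top"
      by (intro tendsto_intros) real_asymp
    then have "\<forall>\<^sub>F x in at_top. 1 / x\<^sup>2 * ln K + - (1 - \<delta>)\<^sup>2 / (2 * T) < a"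
      using a by (intro order_tendstoD(2)) auto
    then show ?thesis
      using eventually_ge_at_top[of 1]
    proof eventually_elim
      case (elim x)
      have "ln (p x) \<le> ln (K * exp (- ((1 - \<delta>) * x)\<^sup>2 / (2 * T)))"
        using p_le[of x] p_pos[of x] elim K by (intro ln_mono) auto
      also have "\<dots> = ln K + - ((1 - \<delta>) * x)\<^sup>2 / (2 * T)"
        using K by (simp add: ln_mult)
      finally have "1 / x\<^sup>2 * ln (p x) \<le> 1 / x\<^sup>2 * (ln K + - ((1 - \<delta>) * x)\<^sup>2 / (2 * T))"
        by (intro mult_left_mono) auto
      also have "\<dots> = 1 / x\<^sup>2 * ln K + - (1 - \<delta>)\<^sup>2 / (2 * T)"
        unfolding power_mult_distrib distrib_left using elim by simp
      finally show ?case using elim by linarith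
    qed
  qed
  show ?thesis
    using order_tendstoI[OF lower upper] unfolding p_def T_def .
qed

end
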